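(* There is a constant $C_{n,s,\theta}>0$, depending only on $n,s,\theta$, for which the following holds. Let $T\subset\mathbb{R}^n$ be a hyperplane perpendicular to $\mathbf{e}$, let $\Sigma$ be the open half-space on one side of $T$, and let $\tilde x$ denote the reflection of $x$ with respect to $T$. Suppose $0\notin\Sigma$. Let $\Omega$ be an unbounded open set in $\Sigma$. Assume $w\in\mathcal{L}_s(\mathbb{R}^n)\cap C^{1,1}_{loc}(\Omega)$ is a solution of $$\begin{cases}\mathbf{F_s}w(x)-c(x)w(x)\le 0 & \text{at points } x\in\Omega \text{ where } w(x)<0,\\ w(x)\ge 0 & \text{in } \Sigma\setminus\Omega,\\ w(\tilde x)=-w(x) & \text{in } \Sigma\end{cases}$$ with $$\liminf_{\substack{x\in\Omega,\ w(x)<0\\ |x|\to+\infty}}|x|^{2s}c(x)>-\frac{C_{n,s,\theta}}{4}.$$ Then there exists a constant $R_0>0$ (depending only on $c(x)$, $\theta$, $n$ and $s$, but independent of $w$ and $\Sigma$) such that, if $\hat x\in\Omega$ satisfies $$w(\hat x)=\min_{\overline\Omega}w(x)<0,$$ then $|\hat x|\le R_0$.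
   Context: Let $n\ge 2$, $0<s<1$ and $0<\theta\le\Theta<\infty$. $\mathcal{L}_s(\mathbb{R}^n)$ is the set of functions $u:\mathbb{R}^n\to\mathbb{R}$ with $\int_{\mathbb{R}^n}\frac{|u(x)|}{1+|x|^{n+2s}}\,dx<+\infty$. $C^{1,1}_{loc}(\Omega)$ denotes functions that are $C^1$ with locally Lipschitz gradient in $\Omega$. Fix a unit vector $\mathbf{e}\in\mathbb{R}^n$. For $u\in\mathcal{L}_s(\mathbb{R}^n)$ that is $C^{1,1}$ near $x$, $$\mathbf{F_s}u(x):=\inf\left\{P.V.\int_{\mathbb{R}^n}\frac{u(y)-u(x)}{|A^{-1}(y-x)|^{n+2s}}\,dy \;:\; A \text{ a real symmetric } n\times n \text{ matrix},\ \theta I\le A\le\Theta I,\ \mathbf{e} \text{ is an eigenvector of } A\right\}.$$ P.V. denotes the Cauchy principal value.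
   Formalization: The liminf of |x|^{2s}c(x) is taken over a set D containing the points of Ω where w<0, viewed as the domain of c, and R_0 may depend on D as well as on c; with c on all of R^n and the liminf over the w-dependent set, an R_0 independent of w need not exist. *)

theory Defs
  imports "HOL-Analysis.Analysis"
begin

text \<open>The dimension \<open>n\<close> is \<open>CARD('n)\<close>. All integrals are Lebesgue integrals, so
  ``function'' in the definition of the weighted space means Lebesgue measurable function.\<close>

definition weighted_L :: "real \<Rightarrow> (real^'n \<Rightarrow> real) set" where
  "weighted_L s = {u. u \<in> borel_measurable lebesgue \<and>
     integrable lebesgue (\<lambda>x. \<bar>u x\<bar> / (1 + norm x powr (real CARD('n) + 2 * s)))}"

definition C11_loc :: "'a::euclidean_space set \<Rightarrow> ('a \<Rightarrow> real) set" where
  "C11_loc \<Omega> = {u. \<exists>g. (\<forall>x\<in>\<Omega>. GDERIV u x :> g x) \<and> continuous_on \<Omega> g \<and>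
     (\<forall>x\<in>\<Omega>. \<exists>r>0. \<exists>L. ball x r \<subseteq> \<Omega> \<and> L-lipschitz_on (ball x r) g)}"

definition PV_integral :: "'a::euclidean_space \<Rightarrow> ('a \<Rightarrow> real) \<Rightarrow> real" where
  "PV_integral x f =
     Lim (at_right 0) (\<lambda>\<epsilon>. LINT y : - ball x \<epsilon> | lebesgue. f y)"

definition eigenvector :: "real^'n^'n \<Rightarrow> real^'n \<Rightarrow> bool" where
  "eigenvector A v \<longleftrightarrow> v \<noteq> 0 \<and> (\<exists>k. A *v v = k *\<^sub>R v)"

definition loewner_le :: "real^'n^'n \<Rightarrow> real^'n^'n \<Rightarrow> bool" where
  "loewner_le A B \<longleftrightarrow> (\<forall>x. x \<bullet> (A *v x) \<le> x \<bullet> (B *v x))"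

definition admissible :: "real \<Rightarrow> real \<Rightarrow> real^'n \<Rightarrow> (real^'n^'n) set" where
  "admissible \<theta> \<Theta> e = {A. transpose A = A \<and>
     loewner_le (\<theta> *\<^sub>R mat 1) A \<and> loewner_le A (\<Theta> *\<^sub>R mat 1) \<and> eigenvector A e}"

text \<open>For \<open>u \<in> weighted_L s\<close> that is \<open>C\<^sup>1\<^sup>,\<^sup>1\<close> near \<open>x\<close> all the principal values exist and
  are bounded uniformly in \<open>A\<close>; only then is the real-valued \<open>Inf\<close> meaningful.\<close>

definition Fs :: "real \<Rightarrow> real \<Rightarrow> real \<Rightarrow> real^'n \<Rightarrow> (real^'n \<Rightarrow> real) \<Rightarrow> real^'n \<Rightarrow> real" where
  "Fs s \<theta> \<Theta> e u x =
     (INF A \<in> admissible \<theta> \<Theta> e.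
        PV_integral x (\<lambda>y. (u y - u x) / norm (matrix_inv A *v (y - x)) powr (real CARD('n) + 2 * s)))"

text \<open>For a unit vector \<open>e\<close>, the hyperplanes perpendicular to \<open>e\<close> are the sets
  \<open>{x. e \<bullet> x = b}\<close>.\<close>

definition open_sides :: "'a::euclidean_space \<Rightarrow> real \<Rightarrow> 'a set set" where
  "open_sides e b = {{x. e \<bullet> x < b}, {x. e \<bullet> x > b}}"

definition reflection :: "'a::euclidean_space \<Rightarrow> real \<Rightarrow> 'a \<Rightarrow> 'a" where
  "reflection e b x = x - (2 * (e \<bullet> x - b)) *\<^sub>R e"

text \<open>The limit inferior as \<open>|x| \<rightarrow> \<infinity>\<close> with \<open>x \<in> D\<close>. If \<open>D\<close> is bounded, it is \<open>\<infinity>\<close>.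
  In the theorem \<open>D\<close> is the domain of the coefficient \<open>c\<close>, which is only needed on the set
  where \<open>w\<close> is negative in \<open>\<Omega>\<close>. Making the domain part of the data of \<open>c\<close> lets the bound on
  the minimum point depend on \<open>c\<close> alone and not on \<open>w\<close>.\<close>

definition liminf_infinity :: "'a::real_normed_vector set \<Rightarrow> ('a \<Rightarrow> real) \<Rightarrow> ereal" where
  "liminf_infinity D f = Liminf (inf at_infinity (principal D)) (\<lambda>x. ereal (f x))"

end

(* A negative minimum point x over the closure of Omega is a minimum over all of Sigma. As w is C^{1,1}
   with vanishing gradient at x, the integrand is absolutely integrable, and so the principal value is
   a Lebesgue integral. Folding it along the reflection and using that reflecting y in Sigma
   increases |A^{-1}(y - x)| (e is an eigenvector of A), one bounds it below by -2 w(x) times the integral of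
   the kernel over the opposite side. As 0 is not in Sigma, that side contains a ball of radius |x|
   within distance 3|x| of x, so F_s w(x) >= - (C/4) w(x) |x|^{-2s}. Together with the
   differential inequality this gives |x|^{2s} c(x) <= -C/4, which is false for large |x|. *)

theory Submission
  imports Defs
begin

section \<open>Lebesgue measure under translations and orthogonal maps\<close>

lemma translation_nn_integral_lborel:
  fixes f :: "'a::euclidean_space \<Rightarrow> ennreal"
  assumes [measurable]: "f \<in> borel_measurable borel"
  shows "(\<integral>\<^sup>+x. f (a + x) \<partial>lborel) = (\<integral>\<^sup>+x. f x \<partial>lborel)"
proof -
  have "(\<integral>\<^sup>+x. f x \<partial>lborel) = (\<integral>\<^sup>+x. f x \<partial>distr lborel borel ((+) a))"
    by (simp add: lborel_distr_plus)
  also have "\<dots> = (\<integral>\<^sup>+x. f (a + x) \<partial>lborel)"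
    by (subst nn_integral_distr) auto
  finally show ?thesis by simp
qed

text \<open>The library's change of variables needs a well-ordered index type. Instead, Tonelli's theorem
  is applied to \<open>indicator A (f x) * indicator B (y - f x)\<close> with the \<open>f\<close>-invariant unit ball \<open>B\<close>,
  as in the uniqueness proof of Haar measure.\<close>

lemma distr_lborel_orthogonal_transformation:
  fixes f :: "'a::euclidean_space \<Rightarrow> 'a"
  assumes f: "orthogonal_transformation f"
  shows "distr lborel borel f = lborel"
proof (rule measure_eqI)
  show "sets (distr lborel borel f) = sets lborel" by simp
next
  fix A assume "A \<in> sets (distr lborel borel f)"
  then have A[measurable]: "A \<in> sets borel" by simp
  have lin: "linear f" using f by (rule orthogonal_transformation_linear)
  have fm[measurable]: "f \<in> borel_measurable borel"
    using lin by (intro borel_measurable_continuous_onI linear_continuous_on) (simp add: linear_conv_bounded_linear)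
  define B where "B = (ball 0 1 :: 'a set)"
  have B[measurable]: "B \<in> sets borel" by (simp add: B_def)
  have eB: "emeasure lborel B = ennreal (unit_ball_vol (real DIM('a)))"
    using emeasure_ball[of 1 "0::'a"] by (simp add: B_def)
  \<comment> \<open>Positive and finite, so that the measure of \<open>B\<close> can be cancelled at
    the end.\<close>
  have B0: "emeasure lborel B \<noteq> 0" "emeasure lborel B \<noteq> top"
    by (auto simp: eB ennreal_eq_0_iff not_le)
  obtain g where g: "\<And>y. f (g y) = y"
    using orthogonal_transformation_surj[OF f] by (metis surjD)
  let ?L = "lborel :: 'a measure"
  have "emeasure lborel (f -` A) * emeasure lborel B
      = (\<integral>\<^sup>+x. indicator A (f x) * emeasure lborel B \<partial>?L)"
  proof -
    have "(\<integral>\<^sup>+x. indicator A (f x) \<partial>?L) = (\<integral>\<^sup>+x. indicator (f -` A) x \<partial>?L)"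
      by (intro nn_integral_cong) (auto simp: indicator_def)
    also have "\<dots> = emeasure lborel (f -` A)"
      using measurable_sets[OF fm A] by simp
    finally show ?thesis by (simp add: nn_integral_multc)
  qed
  also have "\<dots> = (\<integral>\<^sup>+x. (\<integral>\<^sup>+y. indicator A (f x) * indicator B (- f x + y) \<partial>?L) \<partial>?L)"
    by (intro nn_integral_cong) (simp add: nn_integral_cmult translation_nn_integral_lborel[of "indicator B"] del: uminus_add_conv_diff)
  also have "\<dots> = (\<integral>\<^sup>+y. (\<integral>\<^sup>+x. indicator A (f x) * indicator B (- f x + y) \<partial>?L) \<partial>?L)"
    by (rule lborel_pair.Fubini') measurable
  \<comment> \<open>For fixed \<open>y\<close>, translating \<open>x\<close> by a preimage
    \<open>g y\<close> of \<open>y\<close> replaces \<open>f x\<close> by \<open>y + f x\<close>.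
    After the next exchange of integrals \<open>y\<close> occurs only in the indicator of
    \<open>A\<close>, and translation invariance frees it from \<open>f\<close>.\<close>
  also have "\<dots> = (\<integral>\<^sup>+y. (\<integral>\<^sup>+x. indicator A (y + f x) * indicator B (- f x) \<partial>?L) \<partial>?L)"
  proof (rule nn_integral_cong)
    fix y :: 'a
    have "(\<integral>\<^sup>+x. indicator A (f x) * indicator B (- f x + y) \<partial>?L)
        = (\<integral>\<^sup>+x. indicator A (f (g y + x)) * indicator B (- f (g y + x) + y) \<partial>?L)"
      by (rule translation_nn_integral_lborel[symmetric]) measurable
    then show "(\<integral>\<^sup>+x. indicator A (f x) * indicator B (- f x + y) \<partial>?L)
        = (\<integral>\<^sup>+x. indicator A (y + f x) * indicator B (- f x) \<partial>?L)"
      by (simp add: linear_add[OF lin] g)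
  qed
  also have "\<dots> = (\<integral>\<^sup>+x. (\<integral>\<^sup>+y. indicator A (y + f x) * indicator B (- f x) \<partial>?L) \<partial>?L)"
    by (rule lborel_pair.Fubini'[symmetric]) measurable
  also have "\<dots> = (\<integral>\<^sup>+x. emeasure lborel A * indicator B x \<partial>?L)"
  proof (rule nn_integral_cong)
    fix x :: 'a
    have "(\<integral>\<^sup>+y. indicator A (y + f x) \<partial>?L) = emeasure lborel A"
      using translation_nn_integral_lborel[of "indicator A" "f x"] by (simp add: add.commute)
    moreover have "- f x \<in> B \<longleftrightarrow> x \<in> B"
      by (simp add: B_def orthogonal_transformation_norm[OF f])
    ultimately show "(\<integral>\<^sup>+y. indicator A (y + f x) * indicator B (- f x) \<partial>?L) = emeasure lborel A * indicator B x"
      by (simp add: nn_integral_multc indicator_def)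
  qed
  also have "\<dots> = emeasure lborel A * emeasure lborel B"
    by (simp add: nn_integral_cmult)
  finally have "emeasure lborel (f -` A) = emeasure lborel A"
    using B0 ennreal_mult_cancel_left[of "emeasure lborel B"] by (simp add: mult.commute[of _ "emeasure lborel B"])
  then show "emeasure (distr lborel borel f) A = emeasure lborel A"
    by (simp add: emeasure_distr)
qed

text \<open>Carries invariance of Borel measure over to Lebesgue integrals: \<open>T\<close> pulls
  null sets back to null sets, so it is measurable between the completions, and the image of the
  completed measure is again the completed measure.\<close>

lemma integral_completion_measure_preserving:
  fixes g :: "'a \<Rightarrow> real"
  assumes T[measurable]: "T \<in> M \<rightarrow>\<^sub>M M" and eq: "distr M M T = M" and g: "integrable (completion M) g"
  shows "integrable (completion M) (\<lambda>x. g (T x))"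
    and "(\<integral>x. g (T x) \<partial>completion M) = (\<integral>x. g x \<partial>completion M)"
proof -
  have "T \<in> completion M \<rightarrow>\<^sub>M M" by (rule measurable_completion) fact
  moreover have d: "distr (completion M) M T = M" using eq by (simp add: distr_completion)
  ultimately have T': "T \<in> completion M \<rightarrow>\<^sub>M completion M"
    by (intro completion.measurable_completion2) (auto simp: d)
  have "distr (completion M) (completion M) T = completion M"
    using completion.completion_distr_eq[OF \<open>T \<in> completion M \<rightarrow>\<^sub>M M\<close>] by (simp add: d)
  then show "integrable (completion M) (\<lambda>x. g (T x))"
    "(\<integral>x. g (T x) \<partial>completion M) = (\<integral>x. g x \<partial>completion M)"
    using T' g integrable_distr_eq[OF T', of g] integral_distr[OF T', of g]
    by (auto simp: borel_measurable_integrable)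
qed

section \<open>Integrability of powers of the norm\<close>

text \<open>A substitute for polar coordinates: \<open>g\<close> is dominated by the sum of the
  functions \<open>c k\<close> times the indicator of the ball of radius \<open>r k\<close>, and the
  integral of each is \<open>c k * r k ^ DIM('a)\<close> times the volume of the unit ball.\<close>

lemma integrable_by_balls:
  fixes g :: "'a::euclidean_space \<Rightarrow> real"
  assumes [measurable]: "g \<in> borel_measurable borel"
    and nn: "\<And>z. 0 \<le> g z" "\<And>k. 0 \<le> c k" "\<And>k. 0 \<le> r k"
    and cover: "\<And>z. g z \<noteq> 0 \<Longrightarrow> \<exists>k. z \<in> ball 0 (r k) \<and> g z \<le> c k"
    and sum: "summable (\<lambda>k::nat. c k * r k ^ DIM('a))"
  shows "integrable lborel g"
proof (rule integrableI_bounded)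
  have term_le: "f k \<le> suminf f" for f :: "nat \<Rightarrow> ennreal" and k
    using sum_le_suminf[of f "{k}"] by simp
  have "(\<integral>\<^sup>+z. ennreal (norm (g z)) \<partial>lborel) \<le> (\<integral>\<^sup>+z. (\<Sum>k. ennreal (c k) * indicator (ball (0::'a) (r k)) z) \<partial>lborel)"
  proof (intro nn_integral_mono)
    fix z :: 'a
    show "ennreal (norm (g z)) \<le> (\<Sum>k. ennreal (c k) * indicator (ball 0 (r k)) z)"
    proof (cases "g z = 0")
      case False
      then obtain k where k: "z \<in> ball 0 (r k)" "g z \<le> c k" using cover by blast
      have "ennreal (norm (g z)) \<le> ennreal (c k) * indicator (ball 0 (r k)) z"
        using k nn by (simp add: ennreal_leI)
      also have "\<dots> \<le> (\<Sum>k. ennreal (c k) * indicator (ball 0 (r k)) z)"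
        by (rule term_le[of "\<lambda>k. ennreal (c k) * indicator (ball 0 (r k)) z"])
      finally show ?thesis .
    qed simp
  qed
  also have "\<dots> = (\<Sum>k. ennreal (c k) * emeasure lborel (ball (0::'a) (r k)))"
    by (subst nn_integral_suminf)
       (auto simp: nn_integral_cmult_indicator intro!: borel_measurable_times_ennreal borel_measurable_indicator)
  also have "\<dots> = (\<Sum>k. ennreal (unit_ball_vol (real DIM('a)) * (c k * r k ^ DIM('a))))"
    by (simp add: emeasure_ball nn ennreal_mult' mult_ac)
  also have "\<dots> = ennreal (\<Sum>k. unit_ball_vol (real DIM('a)) * (c k * r k ^ DIM('a)))"
    by (rule suminf_ennreal_eq) (auto intro!: summable_sums summable_mult sum mult_nonneg_nonneg zero_le_power nn)
  also have "\<dots> < \<infinity>" by simp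
  finally show "(\<integral>\<^sup>+z. ennreal (norm (g z)) \<partial>lborel) < \<infinity>" .
qed measurable

text \<open>The region is cut into dyadic shells
  \<open>r * 2 ^ k \<le> norm z < r * 2 ^ Suc k\<close>. On each the power is at most its value at
  the inner radius, and the resulting series is geometric with ratio
  \<open>2 powr (-p)\<close>.\<close>

lemma integrable_powr_outside_ball:
  fixes p r :: real
  assumes "0 < p" "0 < r"
  shows "integrable lborel
    (\<lambda>z::'a::euclidean_space. indicator (- ball 0 r) z * norm z powr (- (real DIM('a) + p)))"
proof (rule integrable_by_balls)
  let ?n = "DIM('a)"
  define c \<rho> where "c k = (r * 2 ^ k) powr (- (real ?n + p))" and "\<rho> k = r * 2 ^ Suc k" for k :: nat
  show "0 \<le> c k" "0 \<le> \<rho> k" for k using assms by (auto simp: c_def \<rho>_def)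
  show "0 \<le> indicator (- ball 0 r) z * norm z powr (- (real ?n + p))" for z :: 'a by simp
  show "\<exists>k. z \<in> ball 0 (\<rho> k) \<and> indicator (- ball 0 r) z * norm z powr (- (real ?n + p)) \<le> c k"
    if "indicator (- ball 0 r) z * norm z powr (- (real ?n + p)) \<noteq> 0" for z :: 'a
  proof -
    have z: "r \<le> norm z" using that by (auto simp: indicator_def split: if_splits)
    obtain N where "norm z / r < 2 ^ N" using real_arch_pow[of 2 "norm z / r"] by auto
    then have ex: "norm z < r * 2 ^ N" using assms by (simp add: field_simps)
    \<comment> \<open>The first dyadic radius exceeding \<open>norm z\<close>; it is not the zeroth
      because \<open>r \<le> norm z\<close>, so its predecessor is the index of the shell containing
      \<open>z\<close>.\<close>
    define m where "m = (LEAST k. norm z < r * 2 ^ k)"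
    have m: "norm z < r * 2 ^ m" unfolding m_def using ex by (rule LeastI)
    with z have "m \<noteq> 0" by (intro notI) auto
    then obtain k where k: "m = Suc k" by (cases m) auto
    then have "\<not> norm z < r * 2 ^ k" using not_less_Least[of k "\<lambda>k. norm z < r * 2 ^ k"] m_def by auto
    then have "norm z powr (- (real ?n + p)) \<le> c k"
      unfolding c_def using assms by (intro powr_mono2') auto
    with m k z show ?thesis by (intro exI[of _ k]) (auto simp: \<rho>_def)
  qed
  have "c k * \<rho> k ^ ?n = r powr (-p) * 2 ^ ?n * ((2 powr (-p)) ^ k)" for k
  proof -
    have "c k = (r * 2 ^ k) powr (-p) * (r * 2 ^ k) powr (- real ?n)"
      by (simp add: c_def add.commute flip: powr_add)
    moreover have "(r * 2 ^ k) powr (- real ?n) * (r * 2 ^ k) ^ ?n = 1"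
      using assms by (simp add: powr_minus powr_realpow)
    moreover have "\<rho> k ^ ?n = 2 ^ ?n * (r * 2 ^ k) ^ ?n"
      by (simp add: \<rho>_def power_mult_distrib mult_ac)
    ultimately have "c k * \<rho> k ^ ?n = 2 ^ ?n * (r * 2 ^ k) powr (-p)"
      by (simp add: mult_ac)
    also have "(r * 2 ^ k) powr (-p) = r powr (-p) * ((2 powr (-p)) ^ k)"
      using assms by (simp add: powr_mult powr_power powr_powr flip: powr_realpow) (simp add: mult_ac)
    finally show ?thesis by simp
  qed
  moreover have "2 powr (-p) < (1::real)" using assms by (simp add: powr_minus_divide)
  ultimately show "summable (\<lambda>k. c k * \<rho> k ^ ?n)" by (simp add: summable_mult)
qed (auto intro!: borel_measurable_times borel_measurable_indicator powr_real_measurable)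

text \<open>The same argument with shells shrinking to the origin. By
  \<open>p \<le> real DIM('a)\<close> the exponent is not positive, so the power is again largest at
  the inner radius; the ratio is now \<open>(1/2) powr p\<close>.\<close>

lemma integrable_powr_ball:
  fixes p r :: real
  assumes "0 < p" "p \<le> real DIM('a)" "0 < r"
  shows "integrable lborel
    (\<lambda>z::'a::euclidean_space. indicator (ball 0 r) z * norm z powr (p - real DIM('a)))"
proof (rule integrable_by_balls)
  let ?n = "DIM('a)"
  define c \<rho> where "c k = (r * (1/2) ^ Suc k) powr (p - real ?n)" and "\<rho> k = r * (1/2) ^ k" for k :: nat
  show "0 \<le> c k" "0 \<le> \<rho> k" for k using assms by (auto simp: c_def \<rho>_def)
  show "0 \<le> indicator (ball 0 r) z * norm z powr (p - real ?n)" for z :: 'a by simp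
  show "\<exists>k. z \<in> ball 0 (\<rho> k) \<and> indicator (ball 0 r) z * norm z powr (p - real ?n) \<le> c k"
    if "indicator (ball 0 r) z * norm z powr (p - real ?n) \<noteq> 0" for z :: 'a
  proof -
    \<comment> \<open>The origin lies in no shell, but there the function is zero because
      \<open>0 powr a = 0\<close>.\<close>
    have z: "norm z < r" "0 < norm z" using that by (auto simp: indicator_def split: if_splits)
    obtain N where "(1/2) ^ N < norm z / r" using real_arch_pow_inv[of "norm z / r" "1/2"] z assms by auto
    then have ex: "r * (1/2) ^ N \<le> norm z" using assms by (simp add: field_simps)
    define m where "m = (LEAST k. r * (1/2) ^ k \<le> norm z)"
    have m: "r * (1/2) ^ m \<le> norm z" unfolding m_def using ex by (rule LeastI)
    with z have "m \<noteq> 0" by (intro notI) auto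
    then obtain k where k: "m = Suc k" by (cases m) auto
    then have k': "\<not> r * (1/2) ^ k \<le> norm z" using not_less_Least[of k "\<lambda>k. r * (1/2) ^ k \<le> norm z"] m_def by auto
    have "norm z powr (p - real ?n) \<le> c k"
      unfolding c_def using assms m k by (intro powr_mono2') auto
    with k' z show ?thesis by (intro exI[of _ k]) (auto simp: \<rho>_def)
  qed
  have "c k * \<rho> k ^ ?n = (r/2) powr p * 2 ^ ?n * (((1/2) powr p) ^ k)" for k
  proof -
    have "c k = (r * (1/2) ^ Suc k) powr p * (r * (1/2) ^ Suc k) powr (- real ?n)"
      by (simp add: c_def flip: powr_add)
    moreover have "(r * (1/2) ^ Suc k) powr (- real ?n) * (r * (1/2) ^ Suc k) ^ ?n = 1"
      using assms by (simp add: powr_minus powr_realpow del: power_Suc)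
    moreover have "\<rho> k ^ ?n = 2 ^ ?n * (r * (1/2) ^ Suc k) ^ ?n"
      by (simp add: \<rho>_def flip: power_mult_distrib)
    ultimately have "c k * \<rho> k ^ ?n = 2 ^ ?n * (r * (1/2) ^ Suc k) powr p"
      by (simp add: mult_ac del: power_Suc)
    also have "r * (1/2) ^ Suc k = (r / 2) * (1/2) ^ k" by simp
    also have "((r / 2) * (1/2) ^ k) powr p = (r / 2) powr p * ((1/2) ^ k) powr p"
      by (rule powr_mult)
    also have "((1/2) ^ k) powr p = ((1/2::real) powr p) ^ k"
      by (simp add: powr_power powr_powr mult_ac flip: powr_realpow)
    finally show ?thesis by simp
  qed
  moreover have "(1/2) powr p < (1::real)" using assms powr_less_mono2[of p "1/2" 1] by simp
  ultimately show "summable (\<lambda>k. c k * \<rho> k ^ ?n)" by (simp add: summable_mult)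
qed (auto intro!: borel_measurable_times borel_measurable_indicator powr_real_measurable)

section \<open>Principal values, and the behaviour of \<open>w\<close> near a minimum point\<close>

text \<open>Dominated convergence with majorant \<open>\<bar>f y\<bar>\<close>: the truncated
  integrands are eventually equal to \<open>f y\<close> at every \<open>y\<close> other than the
  centre, which is a null set.\<close>

lemma PV_integral_eq_integral:
  fixes f :: "'a::euclidean_space \<Rightarrow> real"
  assumes f: "integrable lebesgue f"
  shows "PV_integral x f = (LINT y|lebesgue. f y)"
proof -
  have fm[measurable]: "f \<in> borel_measurable lebesgue" using f by (rule borel_measurable_integrable)
  \<comment> \<open>The radius is written as \<open>inverse t\<close> so that dominated convergence
    along \<open>at_top\<close> applies.\<close>
  have "((\<lambda>t. LINT y : - ball x (inverse t) | lebesgue. f y) \<longlongrightarrow> (LINT y|lebesgue. f y)) at_top"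
    unfolding set_lebesgue_integral_def
  proof (rule integral_dominated_convergence_at_top[where w = "\<lambda>y. \<bar>f y\<bar>"])
    show "AE y in lebesgue. ((\<lambda>t. indicator (- ball x (inverse t)) y *\<^sub>R f y) \<longlongrightarrow> f y) at_top"
      using AE_completion[OF AE_lborel_singleton[of x]]
    proof eventually_elim
      case (elim y)
      have "\<forall>\<^sub>F t in at_top. inverse t < dist x y"
        using order_tendstoD(2)[OF tendsto_inverse_0_at_top[OF filterlim_ident], of "dist x y"] elim by auto
      then show ?case
        by (intro tendsto_eventually) (force elim!: eventually_mono)
    qed
    show "(\<lambda>y. indicator (- ball x (inverse t)) y *\<^sub>R f y) \<in> borel_measurable lebesgue" for t
      by (intro borel_measurable_scaleR borel_measurable_indicator fm) auto
  qed (use f in \<open>auto intro!: always_eventually simp: indicator_def\<close>)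
  then have "((\<lambda>\<epsilon>. LINT y : - ball x \<epsilon> | lebesgue. f y) \<longlongrightarrow> (LINT y|lebesgue. f y)) (at_right 0)"
    by (simp add: filterlim_at_right_to_top)
  then show ?thesis
    unfolding PV_integral_def by (intro tendsto_Lim) auto
qed

text \<open>The gradient vanishes at the minimum, so its Lipschitz bound gives
  \<open>norm (g z) \<le> L * dist z x\<close>, and the mean value inequality contributes a second
  factor \<open>norm (y - x)\<close>. The quadratic decay offsets the singularity of the kernel at
  \<open>x\<close>.\<close>

lemma quadratic_bound_at_local_min:
  assumes w: "w \<in> C11_loc \<Omega>" and x: "x \<in> \<Omega>" and min: "\<And>y. y \<in> \<Omega> \<Longrightarrow> w x \<le> w y"
  obtains r L where "0 < r" "0 \<le> L" "\<And>y. y \<in> ball x r \<Longrightarrow> \<bar>w y - w x\<bar> \<le> L * (norm (y - x))\<^sup>2"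
proof -
  obtain g where g: "\<And>z. z \<in> \<Omega> \<Longrightarrow> GDERIV w z :> g z"
    and lip: "\<And>z. z \<in> \<Omega> \<Longrightarrow> \<exists>r>0. \<exists>L. ball z r \<subseteq> \<Omega> \<and> L-lipschitz_on (ball z r) g"
    using w unfolding C11_loc_def by blast
  obtain r L where r: "0 < r" "ball x r \<subseteq> \<Omega>" and L: "L-lipschitz_on (ball x r) g"
    using lip[OF x] by blast
  have d: "(w has_derivative (\<lambda>h. h \<bullet> g z)) (at z)" if "z \<in> ball x r" for z
    using g[of z] that r by (auto simp: gderiv_def)
  have "(\<lambda>h. h \<bullet> g x) = (\<lambda>h. 0)"
    using d[of x] r min by (intro differential_zero_maxmin[of x "ball x r" w]) auto
  then have g0: "g x = 0" by (metis inner_eq_zero_iff)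
  have "\<bar>w y - w x\<bar> \<le> L * (norm (y - x))\<^sup>2" if y: "y \<in> ball x r" for y
  proof -
    let ?\<delta> = "norm (y - x)"
    have sub: "cball x ?\<delta> \<subseteq> ball x r" using y by (auto simp: dist_norm norm_minus_commute)
    have "norm (w y - w x) \<le> (L * ?\<delta>) * norm (y - x)"
    proof (rule differentiable_bound[of "cball x ?\<delta>" w "\<lambda>z h. h \<bullet> g z"])
      show "(w has_derivative (\<lambda>h. h \<bullet> g z)) (at z within cball x ?\<delta>)" if "z \<in> cball x ?\<delta>" for z
        using d sub that by (blast intro: has_derivative_at_withinI)
      show "onorm (\<lambda>h. h \<bullet> g z) \<le> L * ?\<delta>" if z: "z \<in> cball x ?\<delta>" for z
      proof (rule onorm_bound)
        have "norm (g z) = dist (g z) (g x)" by (simp add: g0)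
        also have "\<dots> \<le> L * dist z x" using L z sub r by (intro lipschitz_onD) auto
        also have "\<dots> \<le> L * ?\<delta>"
          using z lipschitz_on_nonneg[OF L] by (intro mult_left_mono) (auto simp: dist_commute)
        finally have gz: "norm (g z) \<le> L * ?\<delta>" .
        show "norm (h \<bullet> g z) \<le> L * ?\<delta> * norm h" for h
        proof -
          have "norm (h \<bullet> g z) \<le> norm h * norm (g z)" using Cauchy_Schwarz_ineq2[of h "g z"] by simp
          also have "\<dots> \<le> norm h * (L * ?\<delta>)" using gz by (intro mult_left_mono) auto
          finally show ?thesis by (simp add: mult_ac)
        qed
      qed (use lipschitz_on_nonneg[OF L] in auto)
    qed (auto simp: dist_norm norm_minus_commute)
    then show ?thesis by (simp add: power2_eq_square mult_ac)
  qed
  with that r lipschitz_on_nonneg[OF L] show thesis by blast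
qed

section \<open>Admissible matrices and the reflection\<close>

text \<open>Both claims come from coercivity,
  \<open>\<theta> * (v \<bullet> v) \<le> v \<bullet> (A *v v)\<close>: it makes the kernel of
  \<open>A\<close> trivial, and combined with Cauchy-Schwarz it bounds the inverse.\<close>

lemma admissible_matrix_inv:
  fixes A :: "real^'n^'n"
  assumes A: "A \<in> admissible \<theta> \<Theta> e" and \<theta>: "0 < \<theta>"
  shows "A *v (matrix_inv A *v z) = z" and "norm (matrix_inv A *v z) \<le> norm z / \<theta>"
proof -
  have low: "\<theta> * (v \<bullet> v) \<le> v \<bullet> (A *v v)" for v
    using A by (auto simp: admissible_def loewner_le_def scaleR_matrix_vector_assoc[symmetric])
  have "v = 0" if "A *v v = 0" for v
    using low[of v] that \<theta> by (simp add: mult_le_0_iff) (metis inner_ge_zero inner_eq_zero_iff order_antisym)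
  then have "invertible A"
    by (metis invertible_left_inverse matrix_left_invertible_ker)
  then have AP: "A ** matrix_inv A = mat 1"
    unfolding matrix_inv_def invertible_def by (rule someI2_ex) simp
  show *: "A *v (matrix_inv A *v z) = z" for z
    by (simp add: matrix_vector_mul_assoc AP)
  let ?v = "matrix_inv A *v z"
  have "\<theta> * norm ?v * norm ?v \<le> norm z * norm ?v"
    using low[of ?v] norm_cauchy_schwarz[of ?v z] by (simp add: * dot_square_norm power2_eq_square mult_ac)
  then have "\<theta> * norm ?v \<le> norm z"
    by (cases "norm ?v = 0") auto
  then show "norm ?v \<le> norm z / \<theta>"
    using \<theta> by (simp add: field_simps)
qed

lemma reflection_reflection: "norm e = 1 \<Longrightarrow> reflection e b (reflection e b x) = x"
  by (simp add: reflection_def inner_diff_right dot_square_norm scaleR_left_diff_distrib algebra_simps)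

lemma inner_reflection: "norm e = 1 \<Longrightarrow> e \<bullet> reflection e b x - b = - (e \<bullet> x - b)"
  by (simp add: reflection_def inner_diff_right dot_square_norm)

text \<open>Makes the kernel larger at \<open>y\<close> than at its mirror image when
  \<open>x\<close> and \<open>y\<close> lie on the same side. Since \<open>e\<close> is an
  eigenvector of the symmetric \<open>A\<close>, with eigenvalue \<open>k > 0\<close>, the inverse
  scales the \<open>e\<close>-component by \<open>1 / k\<close>, so reflecting \<open>y\<close>
  changes the image vector only along \<open>e\<close>.\<close>

lemma norm_matrix_inv_reflection_le:
  fixes A :: "real^'n^'n"
  assumes A: "A \<in> admissible \<theta> \<Theta> e" and \<theta>: "0 < \<theta>" and e: "norm e = 1"
    and side: "0 \<le> (e \<bullet> x - b) * (e \<bullet> y - b)"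
  shows "norm (matrix_inv A *v (y - x)) \<le> norm (matrix_inv A *v (reflection e b y - x))"
proof -
  let ?P = "matrix_inv A"
  obtain k where k: "A *v e = k *\<^sub>R e" using A by (auto simp: admissible_def eigenvector_def)
  have "\<theta> * (e \<bullet> e) \<le> e \<bullet> (A *v e)"
    using A by (auto simp: admissible_def loewner_le_def scaleR_matrix_vector_assoc[symmetric])
  then have k0: "0 < k" using k e \<theta> by (simp add: dot_square_norm)
  have sym: "(A *v u) \<bullet> v = u \<bullet> (A *v v)" for u v
    using A by (simp add: admissible_def flip: dot_lmul_matrix) (metis vector_transpose_matrix)
  have inj: "u = v" if "A *v u = A *v v" for u v
  proof -
    have "\<theta> * ((u - v) \<bullet> (u - v)) \<le> (u - v) \<bullet> (A *v (u - v))"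
      using A by (auto simp: admissible_def loewner_le_def scaleR_matrix_vector_assoc[symmetric])
    then have "\<theta> * ((u - v) \<bullet> (u - v)) \<le> 0" using that by (simp add: matrix_vector_mult_diff_distrib)
    then show ?thesis using \<theta> by (metis inner_ge_zero inner_eq_zero_iff order_antisym mult_le_0_iff not_less eq_iff_diff_eq_0)
  qed
  have Pe: "?P *v e = (1 / k) *\<^sub>R e"
    by (rule inj) (use k k0 admissible_matrix_inv(1)[OF A \<theta>] in \<open>simp add: matrix_vector_mult_scaleR\<close>)
  have ePz: "e \<bullet> (?P *v z) = (e \<bullet> z) / k" for z
    using sym[of e "?P *v z"] k k0 by (simp add: admissible_matrix_inv(1)[OF A \<theta>] field_simps)
  let ?t = "e \<bullet> y - b" and ?v = "?P *v (y - x)"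
  have "?P *v (reflection e b y - x) = ?v - (2 * ?t / k) *\<^sub>R e"
  proof -
    have "reflection e b y - x = (y - x) - (2 * ?t) *\<^sub>R e" by (simp add: reflection_def)
    then show ?thesis by (simp add: matrix_vector_mult_diff_distrib matrix_vector_mult_scaleR Pe)
  qed
  moreover have "(norm (v - c *\<^sub>R e))\<^sup>2 = (norm v)\<^sup>2 - 2 * c * (e \<bullet> v) + c\<^sup>2" for v c
  proof -
    have "e \<bullet> e = 1" using e by (simp add: dot_square_norm)
    moreover have "(v - c *\<^sub>R e) \<bullet> (v - c *\<^sub>R e) = v \<bullet> v - 2 * c * (e \<bullet> v) + c\<^sup>2 * (e \<bullet> e)"
      by (simp add: inner_diff_left inner_diff_right inner_commute[of v e] power2_eq_square right_diff_distrib)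
    ultimately show ?thesis
      by (simp only: power2_norm_eq_inner mult_1_right)
  qed
  ultimately have "(norm (?P *v (reflection e b y - x)))\<^sup>2
      = (norm ?v)\<^sup>2 - 2 * (2 * ?t / k) * (e \<bullet> ?v) + (2 * ?t / k)\<^sup>2"
    by simp
  \<comment> \<open>Here \<open>e \<bullet> ?v = (e \<bullet> y - e \<bullet> x) / k\<close>, and
    \<open>?t - (e \<bullet> y - e \<bullet> x) = e \<bullet> x - b\<close>.\<close>
  also have "\<dots> = (norm ?v)\<^sup>2 + 4 * (?t * (e \<bullet> x - b)) / k\<^sup>2"
    using k0 by (simp add: ePz inner_diff_right field_simps power2_eq_square)
  also have "\<dots> \<ge> (norm ?v)\<^sup>2"
    using side by (simp add: mult.commute)
  finally show ?thesis by (rule power2_le_imp_le) simp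
qed

text \<open>The affine reflection is the linear one, an orthogonal map, followed by translation by
  \<open>(2 * b) *\<^sub>R e\<close>.\<close>

lemma distr_lborel_reflection:
  fixes e :: "'a::euclidean_space"
  assumes e: "norm e = 1"
  shows "reflection e b \<in> borel_measurable borel" and "distr lborel lborel (reflection e b) = lborel"
proof -
  define f where "f x = x - (2 * (e \<bullet> x)) *\<^sub>R e" for x
  have f: "orthogonal_transformation f"
    unfolding orthogonal_transformation_def
  proof
    show "linear f" by (rule linearI) (simp_all add: f_def inner_add_right algebra_simps)
    show "\<forall>v u. f v \<bullet> f u = v \<bullet> u"
      using e by (simp add: f_def inner_diff_left inner_diff_right inner_commute dot_square_norm algebra_simps)
  qed
  have fm[measurable]: "f \<in> borel_measurable borel"
    unfolding f_def by measurable
  have eq: "reflection e b = (\<lambda>x. (2 * b) *\<^sub>R e + x) \<circ> f"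
    by (auto simp: reflection_def f_def algebra_simps)
  show "reflection e b \<in> borel_measurable borel" unfolding eq by measurable
  have "distr lborel borel (reflection e b) = distr (distr lborel borel f) borel ((+) ((2 * b) *\<^sub>R e))"
    unfolding eq by (subst distr_distr) auto
  then show "distr lborel lborel (reflection e b) = lborel"
    by (simp add: distr_lborel_orthogonal_transformation[OF f] lborel_distr_plus cong: distr_cong)
qed

section \<open>Folding the integral along the hyperplane, and integrability of the integrand\<close>

text \<open>For \<open>y\<close> in \<open>\<Sigma>\<close> with mirror image \<open>R y\<close>,
  antisymmetry turns the sum of the two integrands into
  \<open>(w y - w x) * (K y - K (R y)) - 2 * w x * K (R y)\<close>. The product is nonnegative, and
  the remaining term is bounded below through \<open>\<kappa>\<close> when \<open>R y\<close> lies
  in \<open>B\<close>, a set on the opposite side.\<close>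

lemma reflected_integral_lower_bound:
  fixes w K :: "'a::euclidean_space \<Rightarrow> real"
  assumes e: "norm e = 1" and \<Sigma>: "\<Sigma> \<in> open_sides e b"
    and int: "integrable lebesgue (\<lambda>y. (w y - w x) * K y)"
    and anti: "\<And>y. y \<in> \<Sigma> \<Longrightarrow> w (reflection e b y) = - w y"
    and min: "\<And>y. y \<in> \<Sigma> \<Longrightarrow> w x \<le> w y" and neg: "w x \<le> 0"
    and K: "\<And>y. y \<in> \<Sigma> \<Longrightarrow> y \<noteq> x \<Longrightarrow> K (reflection e b y) \<le> K y" "\<And>y. 0 \<le> K y"
    and B: "B \<in> lmeasurable" "\<And>y. y \<in> B \<Longrightarrow> reflection e b y \<in> \<Sigma>" "\<And>y. y \<in> B \<Longrightarrow> \<kappa> \<le> K y"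
  shows "- 2 * w x * \<kappa> * measure lebesgue B \<le> (LINT y|lebesgue. (w y - w x) * K y)"
proof -
  define R where "R = reflection e b"
  define f where "f y = (w y - w x) * K y" for y
  have RR: "R (R y) = y" for y using e by (simp add: R_def reflection_reflection)
  have RS: "R y \<notin> \<Sigma>" if "y \<in> \<Sigma>" for y
    using \<Sigma> that inner_reflection[OF e, of b y] by (auto simp: open_sides_def R_def)
  have cover: "e \<bullet> y = b \<or> y \<in> \<Sigma> \<or> R y \<in> \<Sigma>" for y
    using \<Sigma> inner_reflection[OF e, of b y] by (auto simp: open_sides_def R_def)
  note inv = integral_completion_measure_preserving[of R lborel, folded R_def,
      OF _ distr_lborel_reflection(2)[OF e, of b, folded R_def]]
  have Rm: "R \<in> lborel \<rightarrow>\<^sub>M lborel" using distr_lborel_reflection(1)[OF e, of b] by (simp add: R_def)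
  have f: "integrable lebesgue f" using int by (simp add: f_def[abs_def])
  have i: "integrable lebesgue (indicat_real B)"
    using B(1) by (simp add: lmeasurable_iff_integrable)
  have half: "f y + f (R y) \<ge> - 2 * w x * \<kappa> * (indicator B y + indicator B (R y))" if y: "y \<in> \<Sigma>" for y
  proof -
    have "w (R y) = - w y" using anti[OF y] by (simp add: R_def)
    then have "f y + f (R y) = (w y - w x) * (K y - K (R y)) - 2 * w x * K (R y)"
      by (simp add: f_def algebra_simps)
    \<comment> \<open>At \<open>y = x\<close> the kernels are not compared, but the factor
      \<open>w y - w x\<close> vanishes. In the application \<open>K x\<close> is
      \<open>1 / 0 = 0\<close>, so the comparison would fail there.\<close>
    also have "\<dots> \<ge> - 2 * w x * K (R y)"
      using K(1)[OF y] min[OF y] by (cases "y = x") (auto simp: R_def)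
    finally have 1: "- 2 * w x * K (R y) \<le> f y + f (R y)" .
    have "y \<notin> B" using B(2) RS[OF y] by (auto simp: R_def)
    moreover have "- 2 * w x * \<kappa> * indicator B (R y) \<le> - 2 * w x * K (R y)"
    proof (cases "R y \<in> B")
      case True
      then show ?thesis using mult_left_mono[OF B(3)[of "R y"], of "- 2 * w x"] neg by simp
    next
      case False
      then show ?thesis using mult_nonneg_nonneg[of "- 2 * w x" "K (R y)"] neg K(2)[of "R y"] by simp
    qed
    ultimately show ?thesis using 1 by simp
  qed
  have "AE y in lborel. e \<bullet> y \<noteq> b"
  proof -
    have "negligible {y. e \<bullet> y = b}" using e by (intro negligible_hyperplane) auto
    then have "{y. e \<bullet> y = b} \<in> null_sets lebesgue" by (simp add: negligible_iff_null_sets)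
    then have "AE y in lebesgue. e \<bullet> y \<noteq> b" by (auto dest: AE_not_in)
    then show ?thesis by (simp add: AE_completion_iff)
  qed
  \<comment> \<open>Both sides are symmetric under \<open>R\<close>, so the inequality passes from
    \<open>\<Sigma>\<close> to the opposite side. Integrating over the whole space then counts
    everything twice, and the factor 2 cancels.\<close>
  then have "AE y in lborel. - 2 * w x * \<kappa> * (indicator B y + indicator B (R y)) \<le> f y + f (R y)"
  proof eventually_elim
    case (elim y)
    with cover[of y] consider "y \<in> \<Sigma>" | "R y \<in> \<Sigma>" by blast
    then show ?case
      by cases (use half[of y] half[of "R y"] in \<open>simp_all only: RR add.commute\<close>)
  qed
  then have "AE y in lebesgue. - 2 * w x * \<kappa> * (indicator B y + indicator B (R y)) \<le> f y + f (R y)"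
    by (rule AE_completion)
  then have "(LINT y|lebesgue. - 2 * w x * \<kappa> * (indicator B y + indicator B (R y))) \<le> (LINT y|lebesgue. f y + f (R y))"
    by (intro integral_mono_AE integrable_mult_right Bochner_Integration.integrable_add f i inv(1)[OF Rm f] inv(1)[OF Rm i])
  moreover have "(LINT y|lebesgue. f y + f (R y)) = 2 * (LINT y|lebesgue. f y)"
    by (simp only: Bochner_Integration.integral_add[OF f inv(1)[OF Rm f]] inv(2)[OF Rm f])
  moreover have "(LINT y|lebesgue. - 2 * w x * \<kappa> * (indicator B y + indicator B (R y)))
      = - 2 * w x * \<kappa> * (2 * measure lebesgue B)"
    by (simp only: integral_mult_right_zero Bochner_Integration.integral_add[OF i inv(1)[OF Rm i]] inv(2)[OF Rm i]) simp
  ultimately have "- 2 * w x * \<kappa> * measure lebesgue B \<le> (LINT y|lebesgue. f y)"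
    by linarith
  then show ?thesis unfolding f_def .
qed

text \<open>Near \<open>x\<close> the quadratic bound leaves the integrable power
  \<open>2 - q\<close> of the distance, \<open>q\<close> being the kernel exponent. Away from
  \<open>x\<close> the part with \<open>w x\<close> decays like the power \<open>- q\<close>, and
  the part with \<open>w y\<close> is controlled by the weighted integrability of \<open>w\<close>.
  The constant \<open>\<beta>\<close> compares the kernel with the isotropic one.\<close>

lemma integrable_difference_quotient:
  fixes w :: "real^'n \<Rightarrow> real" and P :: "real^'n^'n"
  assumes n: "CARD('n) \<ge> 2" and s: "0 < s" "s < 1"
    and w: "w \<in> weighted_L s"
    and r: "0 < r" "0 \<le> L" "\<And>y. y \<in> ball x r \<Longrightarrow> \<bar>w y - w x\<bar> \<le> L * (norm (y - x))\<^sup>2"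
    and \<beta>: "\<And>z. norm z \<le> \<beta> * norm (P *v z)" "0 < \<beta>"
  shows "integrable lebesgue (\<lambda>y. (w y - w x) / norm (P *v (y - x)) powr (real CARD('n) + 2 * s))"
proof -
  define q where "q = real CARD('n) + 2 * s"
  have q0: "0 < q" using n s by (simp add: q_def)
  \<comment> \<open>Chosen so that \<open>1 + norm y powr q \<le> M * norm (y - x) powr q\<close>
    once \<open>norm (y - x) \<ge> r\<close>: the first summand accounts for the \<open>1\<close>,
    the second for \<open>norm y \<le> (norm x / r + 1) * norm (y - x)\<close>.\<close>
  define M where "M = r powr (-q) + (norm x / r + 1) powr q"
  define W where "W y = \<bar>w y\<bar> / (1 + norm y powr q)" for y
  define h where "h z = L * (indicator (ball 0 r) z * norm z powr (2 - q))
    + \<bar>w x\<bar> * (indicator (- ball 0 r) z * norm z powr (- q))" for z :: "real^'n"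
  have wm[measurable]: "w \<in> borel_measurable lebesgue"
    and Wi: "integrable lebesgue W" using w by (auto simp: weighted_L_def W_def[abs_def] q_def)
  \<comment> \<open>With \<open>p = 2 - 2 * s\<close> the singular exponent \<open>2 - q\<close> is
    \<open>p\<close> minus the dimension; \<open>p\<close> is positive by \<open>s < 1\<close> and
    at most the dimension because that is at least 2.\<close>
  have q_eq: "2 - 2 * s - real DIM(real^'n) = 2 - q" "- (real DIM(real^'n) + 2 * s) = - q"
    by (simp_all add: q_def)
  have "integrable lborel h"
    using integrable_powr_ball[of "2 - 2 * s" r, where 'a = "real^'n"]
      integrable_powr_outside_ball[of "2 * s" r, where 'a = "real^'n"] n s r
    unfolding h_def[abs_def] q_eq
    by (intro Bochner_Integration.integrable_add integrable_mult_right) simp_all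
  then have "integrable lebesgue h"
    by (simp add: integrable_completion borel_measurable_integrable)
  from integral_completion_measure_preserving(1)[OF _ _ this, of "(+) (- x)"]
  have hi: "integrable lebesgue (\<lambda>y. h (y - x))"
    using lborel_distr_plus[of "- x"] by (simp cong: distr_cong)
  have km: "(\<lambda>y. norm (P *v (y - x)) powr q) \<in> borel_measurable lebesgue"
  proof (rule measurable_completion)
    have "(\<lambda>y. norm (P *v (y - x))) \<in> borel_measurable borel"
      by (intro borel_measurable_continuous_onI continuous_on_norm continuous_on_diff continuous_on_id
          continuous_on_const bounded_linear.continuous_on[OF matrix_vector_mul_bounded_linear])
    then show "(\<lambda>y. norm (P *v (y - x)) powr q) \<in> borel_measurable lborel"
      by (auto intro: powr_real_measurable)
  qed
  have bound: "\<bar>(w y - w x) / norm (P *v (y - x)) powr q\<bar> \<le> \<beta> powr q * (h (y - x) + M * W y)" for y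
  proof (cases "y = x")
    case True
    have "0 \<le> h 0" "0 \<le> M * W x" using r by (auto simp: h_def M_def W_def)
    then show ?thesis by (simp add: True)
  next
    case False
    let ?d = "norm (y - x)"
    have d: "0 < ?d" using False by simp
    have Pd: "0 < norm (P *v (y - x))" using \<beta>(1)[of "y - x"] d by auto
    have "?d powr q \<le> \<beta> powr q * norm (P *v (y - x)) powr q"
      using powr_mono2[of q ?d "\<beta> * norm (P *v (y - x))"] \<beta> q0 by (simp add: powr_mult)
    then have "1 / norm (P *v (y - x)) powr q \<le> \<beta> powr q * ?d powr (-q)"
      using Pd d by (simp add: powr_minus field_simps)
    then have "\<bar>w y - w x\<bar> * (1 / norm (P *v (y - x)) powr q) \<le> \<bar>w y - w x\<bar> * (\<beta> powr q * ?d powr (-q))"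
      by (rule mult_left_mono) simp
    then have 1: "\<bar>(w y - w x) / norm (P *v (y - x)) powr q\<bar> \<le> \<beta> powr q * (\<bar>w y - w x\<bar> * ?d powr (-q))"
      by (simp add: abs_mult mult_ac)
    have "\<bar>w y - w x\<bar> * ?d powr (-q) \<le> h (y - x) + M * W y"
    proof (cases "?d < r")
      case True
      then have "y \<in> ball x r" by (simp add: dist_norm norm_minus_commute)
      then have "\<bar>w y - w x\<bar> * ?d powr (-q) \<le> (L * ?d\<^sup>2) * ?d powr (-q)"
        by (intro mult_right_mono r) auto
      also have "?d\<^sup>2 = ?d powr 2" using d by simp
      also have "(L * ?d powr 2) * ?d powr (-q) = L * ?d powr (2 - q)"
        by (simp add: powr_diff powr_minus divide_inverse)
      also have "\<dots> = h (y - x)" using True by (simp add: h_def)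
      also have "\<dots> \<le> h (y - x) + M * W y" by (simp add: M_def W_def)
      finally show ?thesis .
    next
      case far: False
      have "norm y \<le> norm x + ?d" using norm_triangle_ineq[of x "y - x"] by simp
      also have "\<dots> \<le> (norm x / r + 1) * ?d"
        using far r mult_left_mono[of r ?d "norm x / r"] by (simp add: algebra_simps)
      finally have "norm y powr q \<le> ((norm x / r + 1) * ?d) powr q"
        using q0 by (intro powr_mono2) auto
      then have a: "norm y powr q \<le> (norm x / r + 1) powr q * ?d powr q"
        using r by (simp add: powr_mult)
      have "r powr q \<le> ?d powr q" using q0 far r by (intro powr_mono2) auto
      then have "1 \<le> r powr (-q) * ?d powr q" using r by (simp add: powr_minus field_simps)
      with a have "1 + norm y powr q \<le> M * ?d powr q" by (simp add: M_def algebra_simps)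
      then have "?d powr (-q) \<le> M / (1 + norm y powr q)"
        using d by (simp add: powr_minus field_simps add_pos_nonneg)
      then have "\<bar>w y\<bar> * ?d powr (-q) \<le> \<bar>w y\<bar> * (M / (1 + norm y powr q))"
        by (rule mult_left_mono) simp
      moreover have "\<bar>w y - w x\<bar> * ?d powr (-q) \<le> (\<bar>w y\<bar> + \<bar>w x\<bar>) * ?d powr (-q)"
        by (intro mult_right_mono) auto
      moreover have "h (y - x) = \<bar>w x\<bar> * ?d powr (-q)" using far by (simp add: h_def)
      ultimately show ?thesis by (simp add: W_def algebra_simps)
    qed
    then have "\<beta> powr q * (\<bar>w y - w x\<bar> * ?d powr (-q)) \<le> \<beta> powr q * (h (y - x) + M * W y)"
      by (intro mult_left_mono) auto
    with 1 show ?thesis by linarith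
  qed
  have "integrable lebesgue (\<lambda>y. (w y - w x) / norm (P *v (y - x)) powr q)"
  proof (rule Bochner_Integration.integrable_bound)
    show "integrable lebesgue (\<lambda>y. \<beta> powr q * (h (y - x) + M * W y))"
      by (intro integrable_mult_right Bochner_Integration.integrable_add hi Wi)
    show "(\<lambda>y. (w y - w x) / norm (P *v (y - x)) powr q) \<in> borel_measurable lebesgue"
      by (intro borel_measurable_divide borel_measurable_diff km wm) auto
    show "AE y in lebesgue. norm ((w y - w x) / norm (P *v (y - x)) powr q)
        \<le> norm (\<beta> powr q * (h (y - x) + M * W y))"
      using bound by (intro always_eventually allI) (metis abs_ge_self order_trans real_norm_def)
  qed
  then show ?thesis by (simp add: q_def)
qed

section \<open>Lower bound for \<open>Fs\<close> at a minimum point, and the resulting bound on its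
  norm\<close>

text \<open>The bound is proved for each admissible \<open>A\<close> with the same constant. With
  \<open>r = norm x\<close>, the kernel is at least \<open>(\<theta> / (3 * r)) powr q\<close> on a
  ball of radius \<open>r\<close> beyond the hyperplane; multiplying by the volume of that ball
  leaves the power \<open>- 2 * s\<close> of \<open>r\<close>.\<close>

lemma Fs_lower_bound_at_min:
  fixes w :: "real^'n \<Rightarrow> real"
  assumes n: "CARD('n) \<ge> 2" and s: "0 < s" "s < 1" and \<theta>: "0 < \<theta>" "\<theta> \<le> \<Theta>"
    and e: "norm e = 1" and \<Sigma>: "\<Sigma> \<in> open_sides e b" "0 \<notin> \<Sigma>" and \<Omega>: "\<Omega> \<subseteq> \<Sigma>"
    and w: "w \<in> weighted_L s" "w \<in> C11_loc \<Omega>" and x: "x \<in> \<Omega>" "w x \<le> 0"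
    and min: "\<And>y. y \<in> \<Sigma> \<Longrightarrow> w x \<le> w y"
    and anti: "\<And>y. y \<in> \<Sigma> \<Longrightarrow> w (reflection e b y) = - w y"
  shows "- 2 * w x * (\<theta> / 3) powr (real CARD('n) + 2 * s) * unit_ball_vol (real CARD('n)) * norm x powr (- 2 * s)
    \<le> Fs s \<theta> \<Theta> e w x"
  unfolding Fs_def
proof (rule cINF_greatest)
  have "\<theta> *\<^sub>R mat 1 \<in> admissible \<theta> \<Theta> e"
    using \<theta> e by (auto simp: admissible_def loewner_le_def eigenvector_def transpose_scalar transpose_mat
        scaleR_matrix_vector_assoc[symmetric] intro!: mult_right_mono exI[of _ \<theta>])
  then show "admissible \<theta> \<Theta> e \<noteq> {}" by blast
next
  fix A :: "real^'n^'n" assume A: "A \<in> admissible \<theta> \<Theta> e"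
  define q where "q = real CARD('n) + 2 * s"
  have q0: "0 < q" using n s by (simp add: q_def)
  define P where "P = matrix_inv A"
  define K where "K y = 1 / norm (P *v (y - x)) powr q" for y
  define r where "r = norm x"
  \<comment> \<open>The sign \<open>\<sigma>\<close> treats both sides of the hyperplane at once;
    \<open>\<sigma> *\<^sub>R e\<close> points into \<open>\<Sigma>\<close>.\<close>
  obtain \<sigma> where \<sigma>: "\<bar>\<sigma>\<bar> = 1" "\<sigma> * \<sigma> = 1" "\<Sigma> = {y. 0 < \<sigma> * (e \<bullet> y - b)}"
  proof -
    from \<Sigma>(1) consider "\<Sigma> = {y. e \<bullet> y < b}" | "\<Sigma> = {y. e \<bullet> y > b}" by (auto simp: open_sides_def)
    then show thesis by cases (use that[of "-1"] that[of 1] in auto)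
  qed
  have x\<Sigma>: "x \<in> \<Sigma>" using x \<Omega> by blast
  then have r0: "0 < r" using \<Sigma>(2) by (auto simp: r_def)
  \<comment> \<open>The centre is \<open>x\<close> moved by \<open>2 * r\<close> towards the
    hyperplane. On the ball, \<open>\<sigma> * (e \<bullet> y) < r + (r - 2 * r) = 0\<close>, and
    \<open>\<sigma> * b \<ge> 0\<close> because the origin is not in \<open>\<Sigma>\<close>; so the
    ball lies beyond the hyperplane.\<close>
  define a where "a = x - (2 * r * \<sigma>) *\<^sub>R e"
  \<comment> \<open>This bound on \<open>A\<close> serves only integrability and the positivity of
    \<open>norm (P *v (y - x))\<close>, so it does not enter the constant.\<close>
  obtain \<beta> where \<beta>: "0 < \<beta>" "\<And>v. norm (A *v v) \<le> norm v * \<beta>"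
    using bounded_linear.pos_bounded[OF matrix_vector_mul_bounded_linear[of A]] by blast
  then have \<beta>': "norm z \<le> \<beta> * norm (P *v z)" for z
    using \<beta>(2)[of "P *v z"] admissible_matrix_inv(1)[OF A \<theta>(1)] by (simp add: P_def mult.commute)
  obtain \<delta> L where "0 < \<delta>" "0 \<le> L" "\<And>y. y \<in> ball x \<delta> \<Longrightarrow> \<bar>w y - w x\<bar> \<le> L * (norm (y - x))\<^sup>2"
    using quadratic_bound_at_local_min[OF w(2) x(1)] min \<Omega> by blast
  from integrable_difference_quotient[OF n s w(1) this \<beta>' \<beta>(1)]
  have int: "integrable lebesgue (\<lambda>y. (w y - w x) * K y)" by (simp add: K_def q_def)
  have "- 2 * w x * ((\<theta> / (3 * r)) powr q) * measure lebesgue (ball a r) \<le> (LINT y|lebesgue. (w y - w x) * K y)"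
  proof (rule reflected_integral_lower_bound[OF e \<Sigma>(1) int anti min x(2)])
    fix y assume y: "y \<in> \<Sigma>" "y \<noteq> x"
    have "0 < \<sigma> * (e \<bullet> x - b)" "0 < \<sigma> * (e \<bullet> y - b)" using y x\<Sigma> \<sigma>(3) by auto
    then have "0 \<le> (\<sigma> * (e \<bullet> x - b)) * (\<sigma> * (e \<bullet> y - b))"
      by (rule less_imp_le[OF mult_pos_pos])
    also have "\<dots> = (\<sigma> * \<sigma>) * ((e \<bullet> x - b) * (e \<bullet> y - b))" by (simp only: mult_ac)
    finally have "0 \<le> (e \<bullet> x - b) * (e \<bullet> y - b)" using \<sigma> by simp
    then have le: "norm (P *v (y - x)) \<le> norm (P *v (reflection e b y - x))"
      unfolding P_def by (rule norm_matrix_inv_reflection_le[OF A \<theta>(1) e])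
    have "0 < norm (P *v (y - x))" using \<beta>'[of "y - x"] y by auto
    then show "K (reflection e b y) \<le> K y"
      unfolding K_def using le q0 by (intro divide_left_mono powr_mono2 mult_pos_pos) auto
  next
    fix y assume y: "y \<in> ball a r"
    then have ya: "norm (y - a) < r" by (simp add: dist_norm norm_minus_commute)
    have "\<sigma> * (e \<bullet> (y - a)) \<le> norm (y - a)" "\<sigma> * (e \<bullet> x) \<le> r"
      using Cauchy_Schwarz_ineq2[of e "y - a"] Cauchy_Schwarz_ineq2[of e x] e \<sigma>(1)
        abs_ge_self[of "\<sigma> * (e \<bullet> (y - a))"] abs_ge_self[of "\<sigma> * (e \<bullet> x)"]
      by (auto simp: abs_mult r_def)
    moreover have "\<sigma> * (e \<bullet> a) = \<sigma> * (e \<bullet> x) - 2 * r"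
      using e \<sigma>(2) by (simp add: a_def inner_diff_right dot_square_norm algebra_simps)
    moreover have "\<sigma> * b \<ge> 0" using \<Sigma>(2) \<sigma>(3) by simp
    ultimately have "\<sigma> * (e \<bullet> y - b) < 0" using ya by (simp add: inner_diff_right algebra_simps)
    moreover have "\<sigma> * (e \<bullet> reflection e b y - b) = - (\<sigma> * (e \<bullet> y - b))"
      unfolding inner_reflection[OF e] by (rule mult_minus_right)
    ultimately show "reflection e b y \<in> \<Sigma>" using \<sigma>(3) by simp
    have "norm (y - x) \<le> norm (y - a) + norm (a - x)" using norm_triangle_ineq[of "y - a" "a - x"] by simp
    also have "norm (a - x) = 2 * r" using e \<sigma>(1) r0 by (simp add: a_def abs_mult)
    finally have yx: "norm (y - x) \<le> 3 * r" using ya by simp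
    have "y \<noteq> x" using \<open>\<sigma> * (e \<bullet> y - b) < 0\<close> x\<Sigma> \<sigma>(3) by auto
    then have pos: "0 < norm (P *v (y - x))" using \<beta>'[of "y - x"] by auto
    have "norm (P *v (y - x)) \<le> norm (y - x) / \<theta>"
      unfolding P_def by (rule admissible_matrix_inv(2)[OF A \<theta>(1)])
    also have "\<dots> \<le> 3 * r / \<theta>" using yx \<theta> by (intro divide_right_mono) auto
    finally have "1 / (3 * r / \<theta>) powr q \<le> K y"
      unfolding K_def using pos q0 r0 \<theta> by (intro divide_left_mono powr_mono2 mult_pos_pos) auto
    then show "(\<theta> / (3 * r)) powr q \<le> K y"
      using r0 \<theta> by (simp add: powr_divide)
  qed (auto simp: K_def)
  moreover have "measure lebesgue (ball a r) = unit_ball_vol (real CARD('n)) * r powr (real CARD('n))"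
    using r0 by (simp add: content_ball powr_realpow)
  moreover have "(\<theta> / (3 * r)) powr q * r powr (real CARD('n)) = (\<theta> / 3) powr q * r powr (- 2 * s)"
  proof -
    have "(\<theta> / (3 * r)) powr q = (\<theta> / 3) powr q * r powr (-q)"
      using r0 \<theta> by (simp add: powr_divide powr_mult powr_minus field_simps)
    then show ?thesis by (simp add: q_def flip: powr_add)
  qed
  ultimately have "- 2 * w x * (\<theta> / 3) powr q * unit_ball_vol (real CARD('n)) * r powr (- 2 * s)
      \<le> (LINT y|lebesgue. (w y - w x) * K y)"
    by (simp add: mult_ac)
  also have "\<dots> = PV_integral x (\<lambda>y. (w y - w x) * K y)"
    using int by (rule PV_integral_eq_integral[symmetric])
  finally show "- 2 * w x * (\<theta> / 3) powr (real CARD('n) + 2 * s) * unit_ball_vol (real CARD('n)) * norm x powr (- 2 * s)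
    \<le> PV_integral x (\<lambda>y. (w y - w x) / norm (matrix_inv A *v (y - x)) powr (real CARD('n) + 2 * s))"
    by (simp add: K_def q_def P_def r_def)
qed

theorem theorem2p7:
  fixes s \<theta> :: real
  assumes "CARD('n::finite) \<ge> 2" and "0 < s" "s < 1" and "0 < \<theta>"
  shows "\<exists>C>0. \<forall>(D :: (real^'n) set) (c :: real^'n \<Rightarrow> real).
    liminf_infinity D (\<lambda>x. norm x powr (2 * s) * c x) > ereal (- C / 4) \<longrightarrow>
    (\<exists>R\<^sub>0>0. \<forall>\<Theta> e b \<Sigma> \<Omega> w.
       \<theta> \<le> \<Theta> \<and> norm e = 1 \<and>
       \<Sigma> \<in> open_sides e b \<and> 0 \<notin> \<Sigma> \<and>
       open \<Omega> \<and> \<not> bounded \<Omega> \<and> \<Omega> \<subseteq> \<Sigma> \<and>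
       w \<in> weighted_L s \<inter> C11_loc \<Omega> \<and>
       {x \<in> \<Omega>. w x < 0} \<subseteq> D \<and>
       (\<forall>x\<in>\<Omega>. w x < 0 \<longrightarrow> Fs s \<theta> \<Theta> e w x - c x * w x \<le> 0) \<and>
       (\<forall>x\<in>\<Sigma> - \<Omega>. w x \<ge> 0) \<and>
       (\<forall>x\<in>\<Sigma>. w (reflection e b x) = - w x)
       \<longrightarrow> (\<forall>xhat\<in>\<Omega>. w xhat < 0 \<and> (\<forall>x\<in>closure \<Omega>. w xhat \<le> w x) \<longrightarrow> norm xhat \<le> R\<^sub>0))"
proof -
  \<comment> \<open>The factor 8 makes \<open>C / 4\<close> equal to the constant, including its
    factor 2, in the lower bound for \<open>Fs\<close>.\<close>
  define C where "C = 8 * (\<theta> / 3) powr (real CARD('n) + 2 * s) * unit_ball_vol (real CARD('n))"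
  show ?thesis
  proof (rule exI[of _ C], intro conjI allI impI, goal_cases)
    case 1
    show ?case using assms by (simp add: C_def)
  next
    case lim: (2 D c)
    \<comment> \<open>This radius comes from \<open>D\<close> and \<open>c\<close> alone, before
      \<open>\<Theta>\<close>, \<open>\<Sigma>\<close>, \<open>\<Omega>\<close> and \<open>w\<close>
      are fixed; hence the uniformity.\<close>
    obtain R where R: "\<And>x. R \<le> norm x \<Longrightarrow> x \<in> D \<Longrightarrow> - C / 4 < norm x powr (2 * s) * c x"
      using less_LiminfD[OF lim(1)[unfolded liminf_infinity_def]]
      by (auto simp: eventually_inf_principal eventually_at_infinity)
    \<comment> \<open>The \<open>1\<close> makes the final radius positive and ensures
      \<open>norm x > 0\<close> in the contradiction, where the powers of \<open>norm x\<close> must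
      cancel.\<close>
    have "norm x \<le> max R 1"
      if hyps: "\<theta> \<le> \<Theta>" "norm e = 1" "\<Sigma> \<in> open_sides e b" "0 \<notin> \<Sigma>" "\<Omega> \<subseteq> \<Sigma>"
        "w \<in> weighted_L s" "w \<in> C11_loc \<Omega>" "{x \<in> \<Omega>. w x < 0} \<subseteq> D"
        "\<forall>x\<in>\<Omega>. w x < 0 \<longrightarrow> Fs s \<theta> \<Theta> e w x - c x * w x \<le> 0"
        "\<forall>x\<in>\<Sigma> - \<Omega>. w x \<ge> 0" "\<forall>x\<in>\<Sigma>. w (reflection e b x) = - w x"
        "x \<in> \<Omega>" "w x < 0" "\<forall>y\<in>closure \<Omega>. w x \<le> w y"
      for \<Theta> e b \<Sigma> \<Omega> w x
    proof (rule ccontr)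
      assume "\<not> norm x \<le> max R 1"
      then have x: "R \<le> norm x" "0 < norm x" by auto
      \<comment> \<open>Outside \<open>\<Omega>\<close> the values of \<open>w\<close> in
        \<open>\<Sigma>\<close> are nonnegative, hence above \<open>w x < 0\<close>.\<close>
      have "w x \<le> w y" if "y \<in> \<Sigma>" for y
        using \<open>\<forall>y\<in>closure \<Omega>. w x \<le> w y\<close> \<open>\<forall>x\<in>\<Sigma> - \<Omega>. w x \<ge> 0\<close> \<open>w x < 0\<close> that closure_subset[of \<Omega>]
        by (cases "y \<in> \<Omega>") force+
      with hyps have "- 2 * w x * (\<theta> / 3) powr (real CARD('n) + 2 * s) * unit_ball_vol (real CARD('n))
          * norm x powr (- 2 * s) \<le> Fs s \<theta> \<Theta> e w x"
        using assms by (intro Fs_lower_bound_at_min[where \<Omega> = \<Omega> and \<Sigma> = \<Sigma> and b = b]) auto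
      also have "\<dots> \<le> c x * w x" using hyps by simp
      finally have "w x * c x \<ge> w x * (- (C / 4) * norm x powr (- 2 * s))"
        by (simp add: C_def mult_ac)
      then have "c x \<le> - (C / 4) * norm x powr (- 2 * s)"
        by (rule iffD1[OF mult_le_cancel_left_neg[OF \<open>w x < 0\<close>]])
      then have "norm x powr (2 * s) * c x \<le> norm x powr (2 * s) * (- (C / 4) * norm x powr (- 2 * s))"
        by (intro mult_left_mono) auto
      also have "\<dots> = - C / 4" using x by (simp add: powr_minus)
      finally show False using R[of x] x hyps by auto
    qed
    then show ?case by (intro exI[of _ "max R 1"]) auto
  qed
qed

end
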